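(* (a) Let $\gamma$ be an arc of a unit circle of arclength $\theta$, and let $\mathbf n$ be the outer unit normal to the circle. Let $\mathbf b$ be the unit vector bisecting the corresponding circle sector, pointing from the center towards the midpoint of the arc. Then for an arbitrary fixed vector $v\in\mathbb{R}^2$, $$\int_\gamma v\cdot \mathbf n\,ds=2\sin\frac{\theta}{2}\; v\cdot \mathbf b.$$ (b) Let $x_i,x_{i+1}$ be consecutive vertices of a disk-polygon, let $c_{i,i+1}$ be the center and $\theta_{i,i+1}$ the length of the boundary arc $\gamma_{i,i+1}$ joining $x_i$ and $x_{i+1}$, where this arc is strictly contained in a half unit circle. If $v_i,v_{i+1}\in\mathbb{R}^2$ are perturbation vectors for the vertices $x_i,x_{i+1}$ and $V'(0)$ is the corresponding infinitesimal perturbation, then $$\int_{\gamma_{i,i+1}}V'(0)\cdot\mathbf n\,ds=\tan\frac{\theta_{i,i+1}}{2}\Big[(x_i-c_{i,i+1})\cdot v_i+(x_{i+1}-c_{i,i+1})\cdot v_{i+1}\Big].$$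
   Context: A disk-polygon is an intersection of a finite number of closed disks of unit radius in $\mathbb{R}^2$. Its vertices $x_0,\dots,x_{n-1}$, $n\ge3$, are labelled in anti-clockwise order (indices modulo $n$); its boundary between $x_i$ and $x_{i+1}$ is an arc $\gamma_{i,i+1}$ of a unit circle with center denoted $c_{i,i+1}$, and $\mathbf n$ is the outer unit normal. Perturbation: the vertices are moved to $x_j(t)=x_j+tv_j$, where $v_j\in\mathbb{R}^2$. For small $t$ the boundary of the perturbed disk-polygon between $x_i(t)$ and $x_{i+1}(t)$ is an arc of a unit circle whose center $c_{i,i+1}(t)$ is the differentiable function of $t$ determined by $c_{i,i+1}(0)=c_{i,i+1}$ and $$|x_i+tv_i-c_{i,i+1}(t)|=1,\qquad |x_{i+1}+tv_{i+1}-c_{i,i+1}(t)|=1 .$$ The infinitesimal perturbation $V'(0)$ on the arc $\gamma_{i,i+1}$ is the one induced by this displacement of the circle, i.e. on $\gamma_{i,i+1}$ it is the constant vector $V'(0)=c_{i,i+1}'(0)$. *)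

theory Defs
  imports "HOL-Analysis.Analysis"
begin

definition unit_dir :: "real \<Rightarrow> real^2" where
  "unit_dir \<phi> = vector [cos \<phi>, sin \<phi>]"

text \<open>
  The arc of the unit circle around \<open>c\<close> that runs anti-clockwise from polar angle \<open>\<alpha>\<close> to polar
  angle \<open>\<alpha> + \<theta>\<close>, as a path on \<open>[0,1]\<close>. It has constant speed \<open>\<bar>\<theta>\<bar>\<close>, so \<open>\<theta> \<ge> 0\<close> is its arclength
  (lemma \<open>arclength_circle_arc\<close> below).
\<close>

definition circle_arc :: "real^2 \<Rightarrow> real \<Rightarrow> real \<Rightarrow> real \<Rightarrow> real^2" where
  "circle_arc c \<alpha> \<theta> = (\<lambda>s. c + unit_dir (\<alpha> + \<theta> * s))"

text \<open>The integral of a scalar function along a \<open>C\<^sup>1\<close> path with respect to arclength \<open>ds\<close>.\<close>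

definition arclength_integral ::
  "(real \<Rightarrow> 'a::real_normed_vector) \<Rightarrow> ('a \<Rightarrow> real) \<Rightarrow> real" where
  "arclength_integral \<gamma> f =
     integral {0..1} (\<lambda>s. f (\<gamma> s) * norm (vector_derivative \<gamma> (at s within {0..1})))"

definition circle_normal :: "real^2 \<Rightarrow> real^2 \<Rightarrow> real^2" where
  "circle_normal c p = sgn (p - c)"

text \<open>By constant speed, parameter \<open>1/2\<close> is the midpoint of the arc.\<close>

definition sector_bisector :: "real^2 \<Rightarrow> real \<Rightarrow> real \<Rightarrow> real^2" where
  "sector_bisector c \<alpha> \<theta> = sgn (circle_arc c \<alpha> \<theta> (1/2) - c)"

definition disk_polygon :: "(real^2) set \<Rightarrow> bool" where
  "disk_polygon P \<longleftrightarrow> (\<exists>C. finite C \<and> C \<noteq> {} \<and> P = (\<Inter>c\<in>C. cball c 1))"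

text \<open>
  \<open>P\<close> is a disk-polygon with vertices \<open>x 0, \<dots>, x (n - 1)\<close> in anti-clockwise order; its boundary from
  \<open>x i\<close> to the cyclically next vertex is the arc of length \<open>\<theta> i\<close> with center \<open>c i\<close> starting at polar
  angle \<open>\<alpha> i\<close>. Since \<open>P\<close> lies inside each of these circles, running anti-clockwise along them is
  running anti-clockwise along the boundary. The condition \<open>c i \<noteq> c (Suc i mod n)\<close> says
  that the vertices are the actual corners, where two different circles meet.
\<close>

definition labelled_disk_polygon ::
  "(real^2) set \<Rightarrow> nat \<Rightarrow> (nat \<Rightarrow> real^2) \<Rightarrow> (nat \<Rightarrow> real^2) \<Rightarrow> (nat \<Rightarrow> real) \<Rightarrow> (nat \<Rightarrow> real) \<Rightarrow> bool"
  where
  "labelled_disk_polygon P n x c \<alpha> \<theta> \<longleftrightarrow>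
     disk_polygon P \<and> n \<ge> 3 \<and> inj_on x {..<n} \<and>
     (\<forall>i<n. 0 < \<theta> i \<and> \<theta> i < 2 * pi \<and>
        pathstart (circle_arc (c i) (\<alpha> i) (\<theta> i)) = x i \<and>
        pathfinish (circle_arc (c i) (\<alpha> i) (\<theta> i)) = x (Suc i mod n) \<and>
        c i \<noteq> c (Suc i mod n)) \<and>
     frontier P = (\<Union>i<n. path_image (circle_arc (c i) (\<alpha> i) (\<theta> i)))"

definition strictly_in_half_circle :: "real^2 \<Rightarrow> (real^2) set \<Rightarrow> bool" where
  "strictly_in_half_circle c A \<longleftrightarrow> (\<exists>\<beta>. A \<subset> path_image (circle_arc c \<beta> pi))"

text \<open>
  \<open>cc\<close> is the motion of the center of a unit circle, starting at \<open>c\<close>, that keeps it passing through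
  the moving points \<open>x + t *\<^sub>R v\<close> and \<open>y + t *\<^sub>R w\<close> for all \<open>t\<close> close to \<open>0\<close>.
\<close>

definition perturbed_center ::
  "real^2 \<Rightarrow> real^2 \<Rightarrow> real^2 \<Rightarrow> real^2 \<Rightarrow> real^2 \<Rightarrow> (real \<Rightarrow> real^2) \<Rightarrow> bool" where
  "perturbed_center c x v y w cc \<longleftrightarrow>
     cc 0 = c \<and>
     (\<forall>\<^sub>F t in nhds 0. cc differentiable (at t) \<and>
        norm (x + t *\<^sub>R v - cc t) = 1 \<and> norm (y + t *\<^sub>R w - cc t) = 1)"

lemma norm_unit_dir [simp]: "norm (unit_dir \<phi>) = 1"
  by (simp add: unit_dir_def norm_eq_1 inner_vec_def sum_2 flip: power2_eq_square)

lemma unit_dir_has_vector_derivative: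
  "(unit_dir has_vector_derivative unit_dir (\<phi> + pi / 2)) (at \<phi> within S)"
proof -
  have eq: "unit_dir = (\<lambda>\<phi>. cos \<phi> *\<^sub>R axis 1 1 + sin \<phi> *\<^sub>R axis 2 1)"
    by (rule ext) (simp add: unit_dir_def vec_eq_iff forall_2 axis_def)
  show ?thesis
    unfolding eq by (auto intro!: derivative_eq_intros simp: cos_add sin_add)
qed

lemma arclength_circle_arc:
  assumes "0 \<le> \<theta>"
  shows "arclength_integral (circle_arc c \<alpha> \<theta>) (\<lambda>_. 1) = \<theta>"
proof -
  have "vector_derivative (circle_arc c \<alpha> \<theta>) (at s within {0..1})
          = \<theta> *\<^sub>R unit_dir (\<alpha> + \<theta> * s + pi / 2)" if "s \<in> {0..1}" for s
  proof -
    have "((\<lambda>s. \<alpha> + \<theta> * s) has_vector_derivative \<theta>) (at s within {0..1})"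
      by (auto intro!: derivative_eq_intros simp flip: has_real_derivative_iff_has_vector_derivative)
    from vector_diff_chain_within[OF this unit_dir_has_vector_derivative]
    have "(circle_arc c \<alpha> \<theta> has_vector_derivative \<theta> *\<^sub>R unit_dir (\<alpha> + \<theta> * s + pi / 2))
            (at s within {0..1})"
      unfolding circle_arc_def o_def by (auto intro!: derivative_eq_intros)
    then show ?thesis
      using that by (intro vector_derivative_within_closed_interval) auto
  qed
  then have "arclength_integral (circle_arc c \<alpha> \<theta>) (\<lambda>_. 1) = integral {0..1} (\<lambda>s::real. \<theta>)"
    unfolding arclength_integral_def using assms by (intro integral_cong) auto
  then show ?thesis by simp
qed

end

theory Submission
  imports Defs
begin

text \<open>
  Part (a) is the integral of a shifted cosine. For part (b), differentiating
  \<open>\<bar>x\<^sub>i + t v\<^sub>i - c(t)\<bar>\<^sup>2 = 1\<close> and its analogue at \<open>x\<^sub>j\<close> at \<open>t = 0\<close> and adding gives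
  \<open>c'(0) \<bullet> ((x\<^sub>i - c) + (x\<^sub>j - c)) = (x\<^sub>i - c) \<bullet> v\<^sub>i + (x\<^sub>j - c) \<bullet> v\<^sub>j\<close>. The sum of the two radii
  is \<open>2 cos (\<theta>/2) b\<close>, so (a) for \<open>v = c'(0)\<close> yields the claim as soon as
  \<open>cos (\<theta>/2) \<noteq> 0\<close>, that is, unless the arc is itself a half circle.
\<close>

lemma inner_unit_dir: "v \<bullet> unit_dir \<phi> = v $ 1 * cos \<phi> + v $ 2 * sin \<phi>"
  by (simp add: unit_dir_def inner_vec_def sum_2)

text \<open>Sum-to-product about the mean angle \<open>\<alpha> + \<theta> / 2\<close>: the two
  radii are mirror images in the bisector, so their transverse components cancel and each
  contributes \<open>cos (\<theta> / 2)\<close> along it.\<close>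

lemma unit_dir_add_unit_dir:
  "unit_dir \<alpha> + unit_dir (\<alpha> + \<theta>) = (2 * cos (\<theta> / 2)) *\<^sub>R unit_dir (\<alpha> + \<theta> / 2)"
proof -
  \<comment> \<open>Both angles are written as mean angle minus or plus \<open>\<theta> / 2\<close>.
    As \<open>\<alpha>\<close> recurs on the right, the equations are applied by
    \<open>subst\<close>, since simplification with them would loop.\<close>
  have *: "\<alpha> = (\<alpha> + \<theta> / 2) - \<theta> / 2" "\<alpha> + \<theta> = (\<alpha> + \<theta> / 2) + \<theta> / 2" by simp_all
  have "cos \<alpha> + cos (\<alpha> + \<theta>) = 2 * cos (\<theta> / 2) * cos (\<alpha> + \<theta> / 2)"
       "sin \<alpha> + sin (\<alpha> + \<theta>) = 2 * cos (\<theta> / 2) * sin (\<alpha> + \<theta> / 2)"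
    by (subst *(1), subst *(2), simp only: cos_add cos_diff sin_add sin_diff, simp)+
  then show ?thesis
    by (simp add: unit_dir_def vec_eq_iff forall_2)
qed

lemma sector_bisector_eq: "sector_bisector c \<alpha> \<theta> = unit_dir (\<alpha> + \<theta> / 2)"
  by (simp add: sector_bisector_def circle_arc_def sgn_div_norm)

lemma circle_normal_circle_arc:
  "circle_normal c (circle_arc c \<alpha> \<theta> s) = unit_dir (\<alpha> + \<theta> * s)"
  by (simp add: circle_normal_def circle_arc_def sgn_div_norm)

text \<open>The derivative of \<open>unit_dir\<close> is its quarter turn, again a unit vector, so
  the chain rule leaves only the factor \<open>\<theta>\<close>.\<close>

lemma norm_vector_derivative_circle_arc:
  assumes "s \<in> {0..1}"
  shows "norm (vector_derivative (circle_arc c \<alpha> \<theta>) (at s within {0..1})) = \<bar>\<theta>\<bar>"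
proof -
  have "((\<lambda>s. \<alpha> + \<theta> * s) has_vector_derivative \<theta>) (at s within {0..1})"
    by (auto intro!: derivative_eq_intros simp flip: has_real_derivative_iff_has_vector_derivative)
  from vector_diff_chain_within[OF this unit_dir_has_vector_derivative]
  have "(circle_arc c \<alpha> \<theta> has_vector_derivative \<theta> *\<^sub>R unit_dir (\<alpha> + \<theta> * s + pi / 2))
          (at s within {0..1})"
    unfolding circle_arc_def o_def by (auto intro!: derivative_eq_intros)
  then have "vector_derivative (circle_arc c \<alpha> \<theta>) (at s within {0..1})
               = \<theta> *\<^sub>R unit_dir (\<alpha> + \<theta> * s + pi / 2)"
    using assms by (intro vector_derivative_within_closed_interval) auto
  then show ?thesis by simp
qed

lemma arclength_integral_inner_circle_normal:
  assumes "0 \<le> \<theta>"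
  shows "arclength_integral (circle_arc c \<alpha> \<theta>) (\<lambda>p. v \<bullet> circle_normal c p)
           = 2 * sin (\<theta> / 2) * (v \<bullet> sector_bisector c \<alpha> \<theta>)"
proof -
  \<comment> \<open>A primitive of the integrand: the speed \<open>\<theta>\<close> is exactly the
    inner derivative of \<open>\<alpha> + \<theta> * s\<close>, so no division by
    \<open>\<theta>\<close> occurs.\<close>
  define F where "F s = v $ 1 * sin (\<alpha> + \<theta> * s) - v $ 2 * cos (\<alpha> + \<theta> * s)" for s
  have "arclength_integral (circle_arc c \<alpha> \<theta>) (\<lambda>p. v \<bullet> circle_normal c p)
          = integral {0..1} (\<lambda>s. (v \<bullet> unit_dir (\<alpha> + \<theta> * s)) * \<theta>)"
    unfolding arclength_integral_def using assms
    by (intro integral_cong)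
       (simp add: circle_normal_circle_arc norm_vector_derivative_circle_arc)
  also have "\<dots> = F 1 - F 0"
  proof (intro integral_unique fundamental_theorem_of_calculus)
    show "(F has_vector_derivative (v \<bullet> unit_dir (\<alpha> + \<theta> * s)) * \<theta>) (at s within {0..1})" for s
      unfolding F_def
      by (auto intro!: derivative_eq_intros
               simp: inner_unit_dir algebra_simps
               simp flip: has_real_derivative_iff_has_vector_derivative)
  qed simp
  also have "\<dots> = 2 * sin (\<theta> / 2) * (v \<bullet> unit_dir (\<alpha> + \<theta> / 2))"
  proof -
    have *: "\<alpha> = (\<alpha> + \<theta> / 2) - \<theta> / 2" "\<alpha> + \<theta> = (\<alpha> + \<theta> / 2) + \<theta> / 2" by simp_all
    have "sin (\<alpha> + \<theta>) - sin \<alpha> = 2 * sin (\<theta> / 2) * cos (\<alpha> + \<theta> / 2)"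
         "cos \<alpha> - cos (\<alpha> + \<theta>) = 2 * sin (\<theta> / 2) * sin (\<alpha> + \<theta> / 2)"
      by (subst *(1), subst *(2), simp only: cos_add cos_diff sin_add sin_diff, simp)+
    moreover have "F 1 - F 0 = v $ 1 * (sin (\<alpha> + \<theta>) - sin \<alpha>) + v $ 2 * (cos \<alpha> - cos (\<alpha> + \<theta>))"
      by (simp add: F_def algebra_simps)
    ultimately show ?thesis
      by (simp add: inner_unit_dir algebra_simps)
  qed
  finally show ?thesis by (simp add: sector_bisector_eq)
qed

text \<open>A half circle inside another one with the same center must coincide with it, against the
  proper inclusion. This rules out \<open>\<theta> i = pi\<close> in part (b), where the cosine to
  be cancelled vanishes.\<close>

lemma half_circle_not_strictly_in_half_circle:
  "\<not> strictly_in_half_circle c (path_image (circle_arc c \<alpha> pi))"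
proof
  assume "strictly_in_half_circle c (path_image (circle_arc c \<alpha> pi))"
  then obtain \<beta> where
    psub: "path_image (circle_arc c \<alpha> pi) \<subset> path_image (circle_arc c \<beta> pi)"
    by (auto simp: strictly_in_half_circle_def)
  \<comment> \<open>Measured from \<open>\<beta>\<close>, the points of the outer half circle have
    angles in \<open>[0, pi]\<close>, hence nonnegative sine.\<close>
  have sin_nonneg: "0 \<le> sin (\<alpha> - \<beta> + pi * s)" if s: "s \<in> {0..1}" for s
  proof -
    have "circle_arc c \<alpha> pi s \<in> path_image (circle_arc c \<beta> pi)"
      using psubset_imp_subset[OF psub] s by (auto simp only: path_image_def)
    then obtain r where r: "r \<in> {0..1}" and "unit_dir (\<alpha> + pi * s) = unit_dir (\<beta> + pi * r)"
      by (auto simp: path_image_def circle_arc_def)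
    then have eq: "cos (\<alpha> + pi * s) = cos (\<beta> + pi * r)" "sin (\<alpha> + pi * s) = sin (\<beta> + pi * r)"
      by (simp_all add: unit_dir_def vec_eq_iff forall_2)
    have "\<alpha> - \<beta> + pi * s = (\<alpha> + pi * s) - \<beta>" by simp
    then have "sin (\<alpha> - \<beta> + pi * s) = sin ((\<beta> + pi * r) - \<beta>)"
      by (simp only: sin_diff eq)
    also have "\<dots> = sin (pi * r)" by simp
    also have "\<dots> \<ge> 0"
      using r by (intro sin_ge_zero) auto
    finally show ?thesis .
  qed
  \<comment> \<open>The two endpoints give \<open>sin (\<alpha> - \<beta>)\<close> both signs, and
    the midpoint gives the sign of the cosine; so \<open>\<alpha>\<close> and \<open>\<beta>\<close>
    agree modulo \<open>2 * pi\<close>.\<close>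
  have "sin (\<alpha> - \<beta>) = 0" "0 \<le> cos (\<alpha> - \<beta>)"
    using sin_nonneg[of 0] sin_nonneg[of 1] sin_nonneg[of "1/2"] by (simp_all add: sin_add)
  then have sc: "sin (\<alpha> - \<beta>) = 0" "cos (\<alpha> - \<beta>) = 1"
    using sin_cos_squared_add[of "\<alpha> - \<beta>"] by (auto simp: power2_eq_1_iff)
  have "unit_dir (\<alpha> + u) = unit_dir (\<beta> + u)" for u
  proof -
    have "\<alpha> + u = (\<alpha> - \<beta>) + (\<beta> + u)" by simp
    then have "cos (\<alpha> + u) = cos (\<beta> + u)" "sin (\<alpha> + u) = sin (\<beta> + u)"
      by (simp_all only: cos_add[of "\<alpha> - \<beta>"] sin_add[of "\<alpha> - \<beta>"] sc)
    then show ?thesis by (simp add: unit_dir_def)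
  qed
  then have "circle_arc c \<alpha> pi = circle_arc c \<beta> pi"
    by (simp add: circle_arc_def)
  with psub show False by simp
qed

text \<open>The squared distance is constant near \<open>0\<close>, so its derivative, twice the
  product of the radius with the relative velocity, vanishes. It serves for both endpoints of the
  arc.\<close>

lemma inner_velocity_of_unit_distance:
  fixes a :: "'a::real_inner"
  assumes "cc differentiable (at 0)"
    and "\<forall>\<^sub>F t in nhds 0. norm (a + t *\<^sub>R v - cc t) = 1"
  shows "(a - cc 0) \<bullet> vector_derivative cc (at 0) = (a - cc 0) \<bullet> v"
proof -
  define d where "d = vector_derivative cc (at 0)"
  have d: "(cc has_derivative (\<lambda>h. h *\<^sub>R d)) (at 0)"
    using assms(1) unfolding d_def
    by (metis vector_derivative_works has_vector_derivative_def)
  have "((\<lambda>t. (a + t *\<^sub>R v - cc t) \<bullet> (a + t *\<^sub>R v - cc t)) has_real_derivative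
           2 * ((a - cc 0) \<bullet> (v - d))) (at 0)"
    unfolding has_field_derivative_def
    by (rule derivative_eq_intros d refl | simp)+
       (auto simp: fun_eq_iff inner_diff_left inner_diff_right inner_commute algebra_simps)
  moreover have "((\<lambda>t. (a + t *\<^sub>R v - cc t) \<bullet> (a + t *\<^sub>R v - cc t)) has_real_derivative 0) (at 0)"
  proof -
    have ev: "\<forall>\<^sub>F t in nhds 0. (a + t *\<^sub>R v - cc t) \<bullet> (a + t *\<^sub>R v - cc t) = 1"
      using assms(2) by eventually_elim (simp add: dot_square_norm)
    show ?thesis
      using DERIV_cong_ev[OF refl ev refl] by simp
  qed
  ultimately have "2 * ((a - cc 0) \<bullet> (v - d)) = 0"
    by (rule DERIV_unique)
  then show ?thesis by (simp add: d_def inner_diff_right)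
qed

theorem proposition7:
  shows "(\<forall>(c::real^2) (\<alpha>::real) (\<theta>::real) (b::real^2) (v::real^2).
            0 < \<theta> \<longrightarrow> \<theta> \<le> 2 * pi \<longrightarrow> b = sector_bisector c \<alpha> \<theta> \<longrightarrow>
            arclength_integral (circle_arc c \<alpha> \<theta>) (\<lambda>p. v \<bullet> circle_normal c p)
              = 2 * sin (\<theta> / 2) * (v \<bullet> b))
       \<and> (\<forall>(P::(real^2) set) (n::nat) (x::nat \<Rightarrow> real^2) (c::nat \<Rightarrow> real^2)
             (\<alpha>::nat \<Rightarrow> real) (\<theta>::nat \<Rightarrow> real) (v::nat \<Rightarrow> real^2) (i::nat) (j::nat)
             (cc::real \<Rightarrow> real^2) (V'::real^2 \<Rightarrow> real^2).
            labelled_disk_polygon P n x c \<alpha> \<theta> \<longrightarrow>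
            i < n \<longrightarrow> j = Suc i mod n \<longrightarrow>
            strictly_in_half_circle (c i) (path_image (circle_arc (c i) (\<alpha> i) (\<theta> i))) \<longrightarrow>
            perturbed_center (c i) (x i) (v i) (x j) (v j) cc \<longrightarrow>
            (\<forall>p \<in> path_image (circle_arc (c i) (\<alpha> i) (\<theta> i)). V' p = vector_derivative cc (at 0)) \<longrightarrow>
            arclength_integral (circle_arc (c i) (\<alpha> i) (\<theta> i)) (\<lambda>p. V' p \<bullet> circle_normal (c i) p)
              = tan (\<theta> i / 2) * ((x i - c i) \<bullet> v i + (x j - c i) \<bullet> v j))"
proof (rule conjI; intro allI impI)
  fix c :: "real^2" and \<alpha> \<theta> :: real and b v :: "real^2"
  assume "0 < \<theta>" "b = sector_bisector c \<alpha> \<theta>"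
  then show "arclength_integral (circle_arc c \<alpha> \<theta>) (\<lambda>p. v \<bullet> circle_normal c p)
               = 2 * sin (\<theta> / 2) * (v \<bullet> b)"
    by (simp add: arclength_integral_inner_circle_normal)
next
  fix P :: "(real^2) set" and n :: nat and x c :: "nat \<Rightarrow> real^2" and \<alpha> \<theta> :: "nat \<Rightarrow> real"
    and v :: "nat \<Rightarrow> real^2" and i j :: nat and cc :: "real \<Rightarrow> real^2" and V' :: "real^2 \<Rightarrow> real^2"
  let ?\<gamma> = "circle_arc (c i) (\<alpha> i) (\<theta> i)" and ?d = "vector_derivative cc (at 0)"
  assume poly: "labelled_disk_polygon P n x c \<alpha> \<theta>" and i: "i < n" and j: "j = Suc i mod n"
    and half: "strictly_in_half_circle (c i) (path_image ?\<gamma>)"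
    and pc: "perturbed_center (c i) (x i) (v i) (x j) (v j) cc"
    and V': "\<forall>p \<in> path_image ?\<gamma>. V' p = ?d"
  have \<theta>: "0 < \<theta> i" "\<theta> i < 2 * pi"
    and "pathstart ?\<gamma> = x i" "pathfinish ?\<gamma> = x j"
    using poly i j by (auto simp: labelled_disk_polygon_def)
  then have ends: "x i - c i = unit_dir (\<alpha> i)" "x j - c i = unit_dir (\<alpha> i + \<theta> i)"
    by (simp_all add: pathstart_def pathfinish_def circle_arc_def algebra_simps)
  have "\<theta> i \<noteq> pi"
    using half half_circle_not_strictly_in_half_circle by metis
  \<comment> \<open>On \<open>[0, pi]\<close> the cosine is injective, so \<open>pi / 2\<close> is
    its only zero there.\<close>
  then have cos_ne: "cos (\<theta> i / 2) \<noteq> 0"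
    using \<theta> cos_inj_pi[of "\<theta> i / 2" "pi / 2"] by auto
  have cc0: "cc 0 = c i"
    and ev: "\<forall>\<^sub>F t in nhds 0. cc differentiable (at t) \<and>
               norm (x i + t *\<^sub>R v i - cc t) = 1 \<and> norm (x j + t *\<^sub>R v j - cc t) = 1"
    using pc by (auto simp: perturbed_center_def)
  \<comment> \<open>The filter \<open>nhds 0\<close> includes the point \<open>0\<close>
    itself.\<close>
  have diff: "cc differentiable (at 0)"
    using eventually_nhds_x_imp_x[OF ev] by simp
  have "(x i - c i) \<bullet> ?d = (x i - c i) \<bullet> v i" "(x j - c i) \<bullet> ?d = (x j - c i) \<bullet> v j"
    using ev by (auto intro!: inner_velocity_of_unit_distance[OF diff, unfolded cc0]
                      elim: eventually_mono)
  \<comment> \<open>Adding the two constraints isolates the component of the center velocity along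
    the bisector, the only one that enters the integral.\<close>
  then have "(x i - c i) \<bullet> v i + (x j - c i) \<bullet> v j = (unit_dir (\<alpha> i) + unit_dir (\<alpha> i + \<theta> i)) \<bullet> ?d"
    unfolding ends[symmetric] by (simp only: inner_add_left)
  also have "\<dots> = 2 * cos (\<theta> i / 2) * (?d \<bullet> sector_bisector (c i) (\<alpha> i) (\<theta> i))"
    by (simp add: unit_dir_add_unit_dir sector_bisector_eq inner_commute)
  finally have sum: "(x i - c i) \<bullet> v i + (x j - c i) \<bullet> v j
    = 2 * cos (\<theta> i / 2) * (?d \<bullet> sector_bisector (c i) (\<alpha> i) (\<theta> i))" .
  \<comment> \<open>\<open>V'\<close> is prescribed only on the arc, which is where the integrand
    samples it.\<close>
  have "arclength_integral ?\<gamma> (\<lambda>p. V' p \<bullet> circle_normal (c i) p)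
          = arclength_integral ?\<gamma> (\<lambda>p. ?d \<bullet> circle_normal (c i) p)"
    unfolding arclength_integral_def using V' by (intro integral_cong) (simp add: path_image_def)
  also have "\<dots> = 2 * sin (\<theta> i / 2) * (?d \<bullet> sector_bisector (c i) (\<alpha> i) (\<theta> i))"
    using \<theta> by (simp add: arclength_integral_inner_circle_normal)
  \<comment> \<open>Here \<open>sin (\<theta> i / 2)\<close> is written as
    \<open>tan (\<theta> i / 2) * cos (\<theta> i / 2)\<close>, and the cosine is absorbed into
    \<open>sum\<close>.\<close>
  also have "\<dots> = tan (\<theta> i / 2) * ((x i - c i) \<bullet> v i + (x j - c i) \<bullet> v j)"
    using cos_ne by (simp add: sum tan_def)
  finally show "arclength_integral ?\<gamma> (\<lambda>p. V' p \<bullet> circle_normal (c i) p)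
    = tan (\<theta> i / 2) * ((x i - c i) \<bullet> v i + (x j - c i) \<bullet> v j)" .
qed

end
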